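(* The group $\overline{T}$ has continuum many (that is, $2^{\aleph_0}$ many) different subgroups isomorphic to the additive group $\mathbb{Q}$ of rational numbers, all of which contain the center of $\overline{T}$.
   Context: A dyadic rational is a rational number of the form $k/2^m$ with $k\in\mathbb{Z}$, $m\geq 0$. $\overline{T}$ denotes the group (under composition) of all homeomorphisms $f\colon\mathbb{R}\to\mathbb{R}$ satisfying the following conditions: (1) $f$ is piecewise-linear, with finitely many breakpoints on each compact interval; (2) each linear portion of $f$ has the form $f(x)=2^n x+d$, where $n\in\mathbb{Z}$ and $d$ is a dyadic rational; (3) each breakpoint of $f$ has dyadic rational coordinates; (4) $f(x+1)=f(x)+1$ for all $x\in\mathbb{R}$. *)

theory Defs
  imports "HOL-Analysis.Analysis" "HOL-Algebra.Group"
begin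

(* The library's set dyadics contains only the nonnegative dyadic rationals. *)
definition dyadic_rationals :: "real set" where
  "dyadic_rationals = {of_int k / 2 ^ m | (k :: int) (m :: nat). True}"

definition affine_fun_on :: "real set \<Rightarrow> (real \<Rightarrow> real) \<Rightarrow> bool" where
  "affine_fun_on S f \<longleftrightarrow> (\<exists>a b. \<forall>x\<in>S. f x = a * x + b)"

definition breakpoint :: "(real \<Rightarrow> real) \<Rightarrow> real \<Rightarrow> bool" where
  "breakpoint f x \<longleftrightarrow> \<not> (\<exists>e>0. affine_fun_on {x - e<..<x + e} f)"

(* Continuity is not included here: it is part of being a homeomorphism.
   The finite set S contains every breakpoint of f in the interior of the interval. *)
definition locally_finite_PL :: "(real \<Rightarrow> real) \<Rightarrow> bool" where
  "locally_finite_PL f \<longleftrightarrow>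
     (\<forall>a b. \<exists>S. finite S \<and>
        (\<forall>u v. a \<le> u \<and> u < v \<and> v \<le> b \<and> {u<..<v} \<inter> S = {} \<longrightarrow> affine_fun_on {u<..<v} f))"

definition Tbar_set :: "(real \<Rightarrow> real) set" where
  "Tbar_set = {f.
     (\<exists>g. homeomorphism UNIV UNIV f g) \<and>
     locally_finite_PL f \<and>
     (\<forall>u v. u < v \<and> affine_fun_on {u<..<v} f \<longrightarrow>
        (\<exists>(n :: int) d. d \<in> dyadic_rationals \<and> (\<forall>x\<in>{u<..<v}. f x = 2 powi n * x + d))) \<and>
     (\<forall>x. breakpoint f x \<longrightarrow> x \<in> dyadic_rationals \<and> f x \<in> dyadic_rationals) \<and>
     (\<forall>x. f (x + 1) = f x + 1)}"

definition Tbar :: "(real \<Rightarrow> real) monoid" where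
  "Tbar = \<lparr>carrier = Tbar_set, monoid.mult = (\<circ>), one = id\<rparr>"

definition rational_group :: "rat monoid" where
  "rational_group = \<lparr>carrier = UNIV, monoid.mult = (+), one = 0\<rparr>"

definition group_center :: "('a, 'b) monoid_scheme \<Rightarrow> 'a set" where
  "group_center G = {z \<in> carrier G. \<forall>g\<in>carrier G. z \<otimes>\<^bsub>G\<^esub> g = g \<otimes>\<^bsub>G\<^esub> z}"

end

theory Submission
  imports Defs
begin

text \<open>
  Let $t(x) = x + 1$. A dyadic piecewise-linear homeomorphism $h$ of the line that satisfies
  $h(x + 1) = h(x) + N$ turns $t$ into an $N$-th power: the conjugate $h^{-1} t h$ lies in
  $\overline{T}$ and its $N$-th power is $h^{-1} t^N h = t$. Given a sequence of maps $p_k$ with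
  $p_k(x + 1) = p_k(x) + n_k$, the compositions $h_k = p_{k-1} \cdots p_0$ satisfy
  $h_k(x + 1) = h_k(x) + N_k$ with $N_k = n_0 \cdots n_{k-1}$, and $f_k = h_k^{-1} t h_k$ satisfies
  $f_{k+1}^{n_k} = f_k$. If every positive integer divides some $N_k$, the powers of all the $f_k$
  form a group isomorphic to $\mathbb{Q}$, in which $q$ acts as
  $x \mapsto h_k^{-1}(h_k(x) + q N_k)$ for any $k$ such that $q N_k$ is an integer.
  The integers act as the translations by integers.

  When $n$ is not a power of two, say $2^a < n < 2^{a+1}$, there is a map $p$ fixing $0$ with
  $p(x + 1) = p(x) + n$ that has the slopes $2^{a+1}$ and $2^a$ on the two parts of $[0,1]$, and
  another one that has them in the opposite order. Taking $n_k = 3(k+1)$ gives two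
  choices at each level, thus one group for each set of natural numbers. The group
  determines the choices: roots in $\mathbb{Q}$ are unique, so two such groups that coincide share
  all the elements $f_k$ and with them the points $f_k(0) = h_k^{-1}(1)$, but these
  points differ right after the first level where the choices differ
  (\<open>stretching_tower_shift_unit\<close>, \<open>exists_two_stretching_homeos\<close>).

  A central element commutes with all dyadic translations, so by continuity it is a translation;
  commuting with $p^{-1} t p$ for a suitable $p$ with $p(x+1) = p(x)+3$ forces it to be a translation
  by an integer (\<open>center_Tbar_integer_translation\<close>), which belongs to all the groups constructed.
  Finally there are no more than continuum many subgroups isomorphic to $\mathbb{Q}$, since they are
  countable sets of continuous functions.
\<close>

section \<open>Dyadic rationals\<close>

lemma dyadic_of_int [simp]: "of_int k \<in> dyadic_rationals"
  unfolding dyadic_rationals_def by (intro CollectI exI[of _ k] exI[of _ 0]) simp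

lemma dyadic_of_nat [simp]: "of_nat k \<in> dyadic_rationals"
  using dyadic_of_int[of "int k"] by simp

lemma dyadic_0 [simp]: "0 \<in> dyadic_rationals" and dyadic_1 [simp]: "1 \<in> dyadic_rationals"
  using dyadic_of_int[of 0] dyadic_of_int[of 1] by simp_all

lemma dyadic_add:
  assumes "x \<in> dyadic_rationals" "y \<in> dyadic_rationals"
  shows "x + y \<in> dyadic_rationals"
proof -
  from assms obtain k m l n where "x = of_int k / 2 ^ m" "y = of_int l / 2 ^ n"
    unfolding dyadic_rationals_def by auto
  hence "x + y = of_int (k * 2 ^ n + l * 2 ^ m) / 2 ^ (m + n)"
    by (simp add: add_divide_distrib power_add)
  thus ?thesis unfolding dyadic_rationals_def by blast
qed

lemma dyadic_mult:
  assumes "x \<in> dyadic_rationals" "y \<in> dyadic_rationals"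
  shows "x * y \<in> dyadic_rationals"
proof -
  from assms obtain k m l n where "x = of_int k / 2 ^ m" "y = of_int l / 2 ^ n"
    unfolding dyadic_rationals_def by auto
  hence "x * y = of_int (k * l) / 2 ^ (m + n)"
    by (simp add: power_add)
  thus ?thesis unfolding dyadic_rationals_def by blast
qed

lemma dyadic_uminus:
  assumes "x \<in> dyadic_rationals"
  shows "- x \<in> dyadic_rationals"
  using dyadic_mult[OF dyadic_of_int[of "-1"] assms] by simp

lemma dyadic_diff:
  assumes "x \<in> dyadic_rationals" "y \<in> dyadic_rationals"
  shows "x - y \<in> dyadic_rationals"
  using dyadic_add[OF assms(1) dyadic_uminus[OF assms(2)]] by simp

lemma dyadic_inverse_power: "1 / 2 ^ m \<in> dyadic_rationals"
  unfolding dyadic_rationals_def by (intro CollectI exI[of _ 1] exI[of _ m]) simp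

lemma dyadic_power: "2 ^ m \<in> dyadic_rationals"
  using dyadic_of_int[of "2 ^ m"] by simp

lemma dyadic_powi: "2 powi n \<in> dyadic_rationals"
  using dyadic_inverse_power[of "nat (- n)"] dyadic_power[of "nat n"]
  by (cases "n \<ge> 0") (simp_all add: power_int_def divide_simps)

lemmas dyadic_intros =
  dyadic_add dyadic_mult dyadic_uminus dyadic_diff dyadic_power dyadic_inverse_power dyadic_powi

lemma dyadic_rationals_dense: "closure dyadic_rationals = UNIV"
proof -
  have "\<exists>y\<in>dyadic_rationals. dist y x < e" if "e > 0" for x e :: real
  proof -
    obtain m where m: "(1 / 2) ^ m < e"
      using real_arch_pow_inv[of e "1 / 2"] \<open>e > 0\<close> by auto
    define y where "y = of_int \<lfloor>x * 2 ^ m\<rfloor> / (2 ^ m :: real)"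
    have "y * 2 ^ m = of_int \<lfloor>x * 2 ^ m\<rfloor>" by (simp add: y_def)
    hence "\<bar>(y - x) * 2 ^ m\<bar> < 1" unfolding left_diff_distrib by linarith
    hence "\<bar>y - x\<bar> * 2 ^ m < 1" by (simp add: abs_mult)
    hence "dist y x < (1 / 2) ^ m"
      by (simp only: dist_real_def power_one_over) (simp add: field_simps)
    moreover have "y \<in> dyadic_rationals" unfolding y_def dyadic_rationals_def by blast
    ultimately show ?thesis using m by (intro bexI[of _ y]) auto
  qed
  thus ?thesis by (auto simp: closure_approachable)
qed

text \<open>The bare notation for inverses is taken by the inverse in a group.\<close>
abbreviation inverse_fun :: "('a \<Rightarrow> 'b) \<Rightarrow> 'b \<Rightarrow> 'a" where
  "inverse_fun f \<equiv> inv_into UNIV f"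

section \<open>Dyadic piecewise-linear homeomorphisms of the line\<close>

text \<open>On the closed interval $[u,v]$, the function is affine; its slope is a power of two and its
  constant term is dyadic.\<close>

definition dyadic_affine :: "(real \<Rightarrow> real) \<Rightarrow> real \<Rightarrow> real \<Rightarrow> bool" where
  "dyadic_affine f u v \<longleftrightarrow>
     (\<exists>(n :: int) d. d \<in> dyadic_rationals \<and> (\<forall>x\<in>{u..v}. f x = 2 powi n * x + d))"

text \<open>The germ of the function at a point: dyadic affine on either side, and across the point
  unless the point is dyadic. Since both sides include the point, continuity is implied.
  This local form of the conditions on breakpoints and slopes is easily seen to be stable under
  composition and inversion.\<close>

definition dyadic_PL_at :: "(real \<Rightarrow> real) \<Rightarrow> real \<Rightarrow> bool" where
  "dyadic_PL_at f x \<longleftrightarrow>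
     (\<exists>u v. u < x \<and> x < v \<and> dyadic_affine f u x \<and> dyadic_affine f x v \<and>
        (x \<notin> dyadic_rationals \<longrightarrow> dyadic_affine f u v))"

text \<open>The increasing homeomorphisms of the line with such germs everywhere. No periodicity is
  required, because the maps that conjugate roots of the unit translation to translations do not
  commute with it.\<close>

definition dyadic_PL_homeos :: "(real \<Rightarrow> real) set" where
  "dyadic_PL_homeos = {f. strict_mono f \<and> surj f \<and> (\<forall>x. dyadic_PL_at f x)}"

lemma dyadic_affineI:
  assumes "d \<in> dyadic_rationals" "\<And>x. u \<le> x \<Longrightarrow> x \<le> v \<Longrightarrow> f x = 2 powi n * x + d"
  shows "dyadic_affine f u v"
  using assms unfolding dyadic_affine_def by auto

lemma dyadic_affine_subset:
  assumes "dyadic_affine f u v" "u \<le> u'" "v' \<le> v"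
  shows "dyadic_affine f u' v'"
  using assms unfolding dyadic_affine_def by (meson atLeastAtMost_iff order_trans)

lemma dyadic_affine_comp:
  assumes f: "dyadic_affine f u v" and g: "dyadic_affine g (f u) (f v)" and "strict_mono f"
  shows "dyadic_affine (g \<circ> f) u v"
proof -
  from f obtain n d where n: "d \<in> dyadic_rationals" "\<forall>x\<in>{u..v}. f x = 2 powi n * x + d"
    unfolding dyadic_affine_def by auto
  from g obtain m e where
    m: "e \<in> dyadic_rationals" "\<forall>x\<in>{f u..f v}. g x = 2 powi m * x + e"
    unfolding dyadic_affine_def by auto
  have "(g \<circ> f) x = 2 powi (m + n) * x + (2 powi m * d + e)" if "u \<le> x" "x \<le> v" for x
  proof -
    have "f x \<in> {f u..f v}"
      using that strict_mono_less_eq[OF \<open>strict_mono f\<close>] by auto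
    thus ?thesis using n m that by (simp add: power_int_add algebra_simps)
  qed
  moreover have "2 powi m * d + e \<in> dyadic_rationals"
    using n m by (auto intro: dyadic_intros)
  ultimately show ?thesis by (intro dyadic_affineI)
qed

lemma dyadic_affine_inverse:
  assumes f: "dyadic_affine f u v" "strict_mono f" "surj f"
  shows "dyadic_affine (inverse_fun f) (f u) (f v)"
proof -
  from f obtain n d where n: "d \<in> dyadic_rationals" "\<forall>x\<in>{u..v}. f x = 2 powi n * x + d"
    unfolding dyadic_affine_def by auto
  have "inverse_fun f y = 2 powi (- n) * y + (- (2 powi (- n) * d))" if "f u \<le> y" "y \<le> f v" for y
  proof -
    have y: "f (inverse_fun f y) = y" using \<open>surj f\<close> by (simp add: surj_f_inv_f)
    hence "inverse_fun f y \<in> {u..v}"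
      using that strict_mono_less_eq[OF \<open>strict_mono f\<close>] by (metis atLeastAtMost_iff)
    hence "y = 2 powi n * inverse_fun f y + d" using n y by metis
    thus ?thesis by (simp add: power_int_minus field_simps)
  qed
  moreover have "- (2 powi (- n) * d) \<in> dyadic_rationals"
    using n by (auto intro: dyadic_intros)
  ultimately show ?thesis by (intro dyadic_affineI)
qed

lemma dyadic_affine_value_iff:
  assumes "dyadic_affine f u v" "u \<le> x" "x \<le> v"
  shows "f x \<in> dyadic_rationals \<longleftrightarrow> x \<in> dyadic_rationals"
proof -
  from assms obtain n d where
    n: "d \<in> dyadic_rationals" "f x = 2 powi n * x + d"
    unfolding dyadic_affine_def by (meson atLeastAtMost_iff)
  have "x = 2 powi (- n) * (f x - d)" using n by (simp add: power_int_minus)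
  thus ?thesis using n by (metis dyadic_add dyadic_mult dyadic_diff dyadic_powi)
qed

lemma dyadic_PL_at_value_iff:
  assumes "dyadic_PL_at f x"
  shows "f x \<in> dyadic_rationals \<longleftrightarrow> x \<in> dyadic_rationals"
  using assms dyadic_affine_value_iff[of f _ x x] unfolding dyadic_PL_at_def
  by (meson less_imp_le order_refl)

lemma dyadic_PL_homeosD:
  assumes "f \<in> dyadic_PL_homeos"
  shows "strict_mono f" "surj f" "inj f" "dyadic_PL_at f x"
    "inverse_fun f (f x) = x" "f (inverse_fun f x) = x"
  using assms unfolding dyadic_PL_homeos_def
  by (auto simp: strict_mono_imp_inj_on surj_f_inv_f inv_f_f)

lemma dyadic_PL_homeos_inverse:
  assumes "f \<in> dyadic_PL_homeos"
  shows "inverse_fun f \<in> dyadic_PL_homeos"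
proof -
  note f = dyadic_PL_homeosD[OF assms]
  have "strict_mono (inverse_fun f)"
    by (rule strict_monoI) (metis f(1,6) strict_mono_less)
  moreover have "surj (inverse_fun f)" by (metis f(5) surjI)
  moreover have "dyadic_PL_at (inverse_fun f) y" for y
  proof -
    define x where "x = inverse_fun f y"
    have y: "y = f x" using f by (simp add: x_def)
    obtain u v where "u < x" "x < v" "dyadic_affine f u x" "dyadic_affine f x v"
      "x \<notin> dyadic_rationals \<longrightarrow> dyadic_affine f u v"
      using f(4)[of x] unfolding dyadic_PL_at_def by auto
    thus ?thesis unfolding dyadic_PL_at_def y
      using dyadic_PL_at_value_iff[OF f(4)[of x]] f
      by (intro exI[of _ "f u"] exI[of _ "f v"])
        (auto intro: dyadic_affine_inverse simp: strict_mono_less)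
  qed
  ultimately show ?thesis unfolding dyadic_PL_homeos_def by auto
qed

lemma dyadic_PL_homeos_comp:
  assumes "g \<in> dyadic_PL_homeos" "f \<in> dyadic_PL_homeos"
  shows "g \<circ> f \<in> dyadic_PL_homeos"
proof -
  note f = dyadic_PL_homeosD[OF assms(2)] and g = dyadic_PL_homeosD[OF assms(1)]
  have mono: "strict_mono (g \<circ> f)" using f(1) g(1) by (simp add: strict_mono_def)
  moreover have "surj (g \<circ> f)" using f(2) g(2) by (rule comp_surj)
  moreover have "dyadic_PL_at (g \<circ> f) x" for x
  proof -
    obtain u1 v1 where f1: "u1 < x" "x < v1" "dyadic_affine f u1 x" "dyadic_affine f x v1"
      "x \<notin> dyadic_rationals \<longrightarrow> dyadic_affine f u1 v1"
      using f(4)[of x] unfolding dyadic_PL_at_def by auto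
    obtain u2 v2 where g1: "u2 < f x" "f x < v2" "dyadic_affine g u2 (f x)"
      "dyadic_affine g (f x) v2" "f x \<notin> dyadic_rationals \<longrightarrow> dyadic_affine g u2 v2"
      using g(4)[of "f x"] unfolding dyadic_PL_at_def by auto
    define u v where "u = max u1 (inverse_fun f u2)" and "v = min v1 (inverse_fun f v2)"
    have "f (inverse_fun f u2) < f x" "f x < f (inverse_fun f v2)" using g1 f(6) by auto
    hence "inverse_fun f u2 < x" "x < inverse_fun f v2"
      by (auto simp: strict_mono_less[OF f(1)])
    hence uv: "u < x" "x < v" "u1 \<le> u" "v \<le> v1" using f1 by (auto simp: u_def v_def)
    have "f (inverse_fun f u2) \<le> f u" "f v \<le> f (inverse_fun f v2)"
      by (auto simp: strict_mono_less_eq[OF f(1)] u_def v_def)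
    hence fuv: "u2 \<le> f u" "f v \<le> v2" using f(6) by auto
    have "dyadic_affine (g \<circ> f) u x" "dyadic_affine (g \<circ> f) x v"
      using f1 g1 uv fuv f(1) by (auto intro!: dyadic_affine_comp intro: dyadic_affine_subset)
    moreover have "dyadic_affine (g \<circ> f) u v" if "x \<notin> dyadic_rationals"
      using that f1 g1 uv fuv f(1) dyadic_PL_at_value_iff[OF f(4)[of x]]
      by (auto intro!: dyadic_affine_comp intro: dyadic_affine_subset)
    ultimately show ?thesis unfolding dyadic_PL_at_def using uv by blast
  qed
  ultimately show ?thesis unfolding dyadic_PL_homeos_def by auto
qed

lemma dyadic_translation_homeo:
  assumes "c \<in> dyadic_rationals"
  shows "(\<lambda>x. x + c) \<in> dyadic_PL_homeos"
proof -
  have "dyadic_affine (\<lambda>x. x + c) u v" for u v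
    using assms by (intro dyadic_affineI[of c _ _ _ 0]) auto
  hence "dyadic_PL_at (\<lambda>x. x + c) x" for x
    unfolding dyadic_PL_at_def by (intro exI[of _ "x - 1"] exI[of _ "x + 1"]) auto
  moreover have "surj (\<lambda>x. x + c)" by (rule surjI[of _ "\<lambda>x. x - c"]) simp
  ultimately show ?thesis unfolding dyadic_PL_homeos_def by (auto simp: strict_mono_def)
qed

lemma dyadic_PL_homeos_continuous:
  assumes "f \<in> dyadic_PL_homeos"
  shows "continuous_on UNIV f"
  using dyadic_PL_homeosD[OF assms]
  by (intro continuous_onI_mono) (auto simp: strict_mono_less_eq)

lemma affine_fun_on_subset: "affine_fun_on S f \<Longrightarrow> T \<subseteq> S \<Longrightarrow> affine_fun_on T f"
  unfolding affine_fun_on_def by blast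

lemma dyadic_affine_imp_affine: "dyadic_affine f u v \<Longrightarrow> affine_fun_on {u..v} f"
  unfolding dyadic_affine_def affine_fun_on_def by blast

text \<open>Compactness of intervals, in the form of bisection, passes from the local to the
  locally finite description.\<close>

lemma dyadic_PL_homeos_locally_finite_PL:
  assumes "f \<in> dyadic_PL_homeos"
  shows "locally_finite_PL f"
proof -
  note f = dyadic_PL_homeosD[OF assms]
  define P where "P a b \<longleftrightarrow> (\<exists>S. finite S \<and>
    (\<forall>u v. a \<le> u \<and> u < v \<and> v \<le> b \<and> {u<..<v} \<inter> S = {} \<longrightarrow> affine_fun_on {u<..<v} f))" for a b
  have "P a b" if "a \<le> b" for a b
    using that
  proof (induction rule: Bolzano)
    case (trans a b c)
    then obtain S T where ST: "finite S" "finite T"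
      "\<And>u v. a \<le> u \<Longrightarrow> u < v \<Longrightarrow> v \<le> b \<Longrightarrow> {u<..<v} \<inter> S = {} \<Longrightarrow> affine_fun_on {u<..<v} f"
      "\<And>u v. b \<le> u \<Longrightarrow> u < v \<Longrightarrow> v \<le> c \<Longrightarrow> {u<..<v} \<inter> T = {} \<Longrightarrow> affine_fun_on {u<..<v} f"
      unfolding P_def by metis
    have "affine_fun_on {u<..<v} f"
      if "a \<le> u" "u < v" "v \<le> c" "{u<..<v} \<inter> (insert b (S \<union> T)) = {}" for u v
    proof -
      have "v \<le> b \<or> b \<le> u" using that by force
      thus ?thesis using that ST(3)[of u v] ST(4)[of u v] by blast
    qed
    thus ?case unfolding P_def using ST(1,2) by (intro exI[of _ "insert b (S \<union> T)"]) auto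
  next
    case (local x)
    obtain u v where uv: "u < x" "x < v" "dyadic_affine f u x" "dyadic_affine f x v"
      using f(4)[of x] unfolding dyadic_PL_at_def by auto
    have "P a b" if "a \<le> x" "x \<le> b" "b - a < min (x - u) (v - x)" for a b
    proof -
      have "affine_fun_on {s<..<t} f"
        if "a \<le> s" "s < t" "t \<le> b" "{s<..<t} \<inter> {x} = {}" for s t
      proof -
        have "u < a" "b < v" "t \<le> x \<or> x \<le> s" 
          using that \<open>a \<le> x\<close> \<open>x \<le> b\<close> \<open>b - a < _\<close> by auto
        hence "{s<..<t} \<subseteq> {u..x} \<or> {s<..<t} \<subseteq> {x..v}"
          using that by auto
        thus ?thesis
          using affine_fun_on_subset[OF dyadic_affine_imp_affine[OF uv(3)]]
            affine_fun_on_subset[OF dyadic_affine_imp_affine[OF uv(4)]] by blast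
      qed
      thus ?thesis unfolding P_def by (intro exI[of _ "{x}"]) auto
    qed
    thus ?case using uv by (intro exI[of _ "min (x - u) (v - x)"]) auto
  qed
  moreover have "P a b" if "\<not> a \<le> b" for a b
    unfolding P_def using that by (intro exI[of _ "{}"]) auto
  ultimately have "\<forall>a b. P a b" by blast
  thus ?thesis unfolding locally_finite_PL_def P_def .
qed

lemma dyadic_PL_homeos_slope:
  assumes "f \<in> dyadic_PL_homeos" "u < v" "affine_fun_on {u<..<v} f"
  shows "\<exists>(n :: int) d. d \<in> dyadic_rationals \<and> (\<forall>x\<in>{u<..<v}. f x = 2 powi n * x + d)"
proof -
  from assms obtain a b where ab: "\<And>x. u < x \<Longrightarrow> x < v \<Longrightarrow> f x = a * x + b"
    unfolding affine_fun_on_def by auto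
  \<comment> \<open>Compare the affine formula with the germ at an interior point, at that point and at a second
    point \<open>y\<close> to its right.\<close>
  define x where "x = (u + v) / 2"
  have x: "u < x" "x < v" using \<open>u < v\<close> by (auto simp: x_def)
  obtain w where w: "x < w" "dyadic_affine f x w"
    using dyadic_PL_homeosD(4)[OF assms(1), of x] unfolding dyadic_PL_at_def by auto
  then obtain n d where n: "d \<in> dyadic_rationals" "\<forall>y\<in>{x..w}. f y = 2 powi n * y + d"
    unfolding dyadic_affine_def by auto
  define y where "y = min w ((x + v) / 2)"
  have y: "x < y" "y \<le> w" "y < v" using w x by (auto simp: y_def min_less_iff_disj field_simps)
  have "a * x + b = 2 powi n * x + d" "a * y + b = 2 powi n * y + d"
    using ab[of x] ab[of y] n x y w by force+
  hence "(a - 2 powi n) * (y - x) = 0" by (simp add: algebra_simps)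
  hence "a = 2 powi n" using y by simp
  moreover from this have "b = d" using \<open>a * x + b = _\<close> by simp
  ultimately show ?thesis using n ab by auto
qed

lemma dyadic_PL_homeos_imp_Tbar:
  assumes "f \<in> dyadic_PL_homeos" "\<And>x. f (x + 1) = f x + 1"
  shows "f \<in> Tbar_set"
proof -
  note f = dyadic_PL_homeosD[OF assms(1)]
  have "homeomorphism UNIV UNIV f (inverse_fun f)"
    using dyadic_PL_homeos_continuous[OF assms(1)] f
      dyadic_PL_homeos_continuous[OF dyadic_PL_homeos_inverse[OF assms(1)]]
      dyadic_PL_homeosD(2)[OF dyadic_PL_homeos_inverse[OF assms(1)]]
    by (auto simp: homeomorphism_def)
  moreover have "x \<in> dyadic_rationals" if "breakpoint f x" for x
  proof (rule ccontr)
    assume "x \<notin> dyadic_rationals"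
    then obtain u v where uv: "u < x" "x < v" "dyadic_affine f u v"
      using f(4)[of x] unfolding dyadic_PL_at_def by auto
    have "affine_fun_on {x - min (x - u) (v - x)<..<x + min (x - u) (v - x)} f"
      by (rule affine_fun_on_subset[OF dyadic_affine_imp_affine[OF uv(3)]]) auto
    moreover have "min (x - u) (v - x) > 0" using uv by simp
    ultimately show False using that unfolding breakpoint_def by blast
  qed
  ultimately show ?thesis
    unfolding Tbar_set_def mem_Collect_eq using dyadic_PL_homeos_locally_finite_PL[OF assms(1)]
      dyadic_PL_homeos_slope[OF assms(1)] assms(2) dyadic_PL_at_value_iff[OF f(4)]
    by (intro conjI allI impI) auto
qed

lemma Tbar_set_continuous:
  assumes "f \<in> Tbar_set"
  shows "continuous_on UNIV f"
  using assms by (auto simp: Tbar_set_def homeomorphism_def)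


section \<open>Homeomorphisms that turn unit translation into a larger one\<close>

text \<open>For $0 < s < 1$, the continuous map that fixes $0$ and has slope $2^i$ on $[0,s]$ and $2^j$
  on $[s,1]$, extended to the line so that adding $1$ to the argument adds $2^i s + 2^j (1-s)$ to
  the value everywhere.\<close>

definition two_slope :: "nat \<Rightarrow> nat \<Rightarrow> real \<Rightarrow> real \<Rightarrow> real" where
  "two_slope i j s x = of_int \<lfloor>x\<rfloor> * (2 ^ i * s + 2 ^ j * (1 - s)) +
     (if frac x \<le> s then 2 ^ i * frac x else 2 ^ i * s + 2 ^ j * (frac x - s))"

lemma frac_of_int_add: "0 \<le> r \<Longrightarrow> r < 1 \<Longrightarrow> frac (of_int m + r :: real) = r"
  by (simp add: frac_unique_iff)

lemma floor_of_int_add: "0 \<le> r \<Longrightarrow> r < 1 \<Longrightarrow> \<lfloor>of_int m + r :: real\<rfloor> = m"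
  by (simp add: floor_eq_iff)

lemma two_slope_left:
  assumes "0 < s" "s < 1" "of_int m \<le> x" "x \<le> of_int m + s"
  shows "two_slope i j s x = of_int m * (2 ^ i * s + 2 ^ j * (1 - s)) + 2 ^ i * (x - of_int m)"
proof -
  have "\<lfloor>x\<rfloor> = m" "frac x = x - of_int m"
    using assms floor_of_int_add[of "x - of_int m" m] frac_of_int_add[of "x - of_int m" m] by auto
  thus ?thesis using assms by (simp add: two_slope_def)
qed

lemma two_slope_right:
  assumes "0 < s" "s < 1" "of_int m + s \<le> x" "x \<le> of_int m + 1"
  shows "two_slope i j s x =
    of_int m * (2 ^ i * s + 2 ^ j * (1 - s)) + 2 ^ i * s + 2 ^ j * (x - of_int m - s)"
proof (cases "x = of_int (m + 1)")
  case True
  thus ?thesis using assms by (simp add: two_slope_def algebra_simps)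
next
  case False
  hence "x < of_int m + 1" using assms by simp
  hence "\<lfloor>x\<rfloor> = m" "frac x = x - of_int m"
    using assms floor_of_int_add[of "x - of_int m" m] frac_of_int_add[of "x - of_int m" m] by auto
  moreover from this have "frac x = s" if "frac x \<le> s" using that assms by simp
  ultimately show ?thesis by (cases "frac x \<le> s") (simp_all add: two_slope_def)
qed

lemma two_slope_add_1:
  "two_slope i j s (x + 1) = two_slope i j s x + (2 ^ i * s + 2 ^ j * (1 - s))"
proof -
  have "frac (x + 1) = frac x" by (simp add: frac_def)
  thus ?thesis by (simp add: two_slope_def algebra_simps)
qed

lemma two_slope_strict_mono:
  assumes s: "0 < s" "s < 1"
  shows "strict_mono (two_slope i j s)"
proof (rule strict_monoI)
  fix x y :: real assume "x < y"
  define c where "c = 2 ^ i * s + 2 ^ j * (1 - s)"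
  define h where "h r = (if r \<le> s then 2 ^ i * r else 2 ^ i * s + 2 ^ j * (r - s))" for r :: real
  have eq: "two_slope i j s z = of_int \<lfloor>z\<rfloor> * c + h (frac z)" for z
    by (simp add: two_slope_def c_def h_def)
  have c: "c > 0" using s by (simp add: c_def add_pos_pos)
  have h_less: "h q < h r" if "q < r" for q r
  proof -
    have "2 ^ i * q < 2 ^ i * r" "2 ^ j * (q - s) < 2 ^ j * (r - s)" using that by simp_all
    moreover have "2 ^ i * q \<le> 2 ^ i * s" if "q \<le> s" using that by simp
    moreover have "0 < 2 ^ j * (r - s)" if "s < r" using that by simp
    ultimately show ?thesis using that unfolding h_def by (smt (verit))
  qed
  have h01: "h 0 = 0" "h 1 = c" using s by (simp_all add: h_def c_def)
  show "two_slope i j s x < two_slope i j s y"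
  proof (cases "\<lfloor>x\<rfloor> = \<lfloor>y\<rfloor>")
    case True
    hence "frac x < frac y" using \<open>x < y\<close> by (simp add: frac_def)
    thus ?thesis using h_less True by (simp add: eq)
  next
    case False
    hence "\<lfloor>x\<rfloor> + 1 \<le> \<lfloor>y\<rfloor>" using floor_mono[of x y] \<open>x < y\<close> by linarith
    hence "of_int (\<lfloor>x\<rfloor> + 1) * c \<le> of_int \<lfloor>y\<rfloor> * c" using c
      by (intro mult_right_mono) (simp_all del: of_int_add)
    moreover have "h (frac x) < c" using h_less[OF frac_lt_1[of x]] h01 by simp
    moreover have "h (frac y) \<ge> 0"
      using h_less[of 0 "frac y"] h01 frac_ge_0[of y] by (metis less_eq_real_def)
    ultimately show ?thesis by (simp add: eq algebra_simps)
  qed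
qed

lemma two_slope_surj:
  assumes s: "0 < s" "s < 1"
  shows "surj (two_slope i j s)"
unfolding surj_def
proof
  fix y :: real
  define c where "c = 2 ^ i * s + 2 ^ j * (1 - s)"
  have c: "c > 0" using s by (simp add: c_def add_pos_pos)
  define m where "m = \<lfloor>y / c\<rfloor>"
  define r where "r = y - of_int m * c"
  have "of_int m \<le> y / c" "y / c < of_int m + 1" by (auto simp: m_def)
  hence r: "0 \<le> r" "r < c" using c by (simp_all add: r_def field_simps)
  show "\<exists>x. y = two_slope i j s x"
  proof (cases "r \<le> 2 ^ i * s")
    case True
    have "two_slope i j s (of_int m + r / 2 ^ i) = y"
      using True s r by (subst two_slope_left[of _ m]) (auto simp: r_def c_def field_simps)
    thus ?thesis by metis
  next
    case False
    have "two_slope i j s (of_int m + s + (r - 2 ^ i * s) / 2 ^ j) = y"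
      using False s r by (subst two_slope_right[of _ m]) (auto simp: r_def c_def field_simps)
    thus ?thesis by metis
  qed
qed

lemma two_slope_homeo:
  assumes s: "0 < s" "s < 1" "s \<in> dyadic_rationals"
  shows "two_slope i j s \<in> dyadic_PL_homeos"
proof -
  let ?f = "two_slope i j s"
  define c where "c = 2 ^ i * s + 2 ^ j * (1 - s)"
  have c: "c \<in> dyadic_rationals" unfolding c_def using s by (auto intro!: dyadic_intros)
  have L: "dyadic_affine ?f (of_int m) (of_int m + s)" for m
  proof (rule dyadic_affineI[of _ _ _ _ "int i"])
    show "of_int m * c - 2 ^ i * of_int m \<in> dyadic_rationals"
      using c by (auto intro!: dyadic_intros)
  qed (simp add: two_slope_left[of s m] s c_def algebra_simps)
  have R: "dyadic_affine ?f (of_int m + s) (of_int m + 1)" for m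
  proof (rule dyadic_affineI[of _ _ _ _ "int j"])
    show "of_int m * c + 2 ^ i * s - 2 ^ j * (of_int m + s) \<in> dyadic_rationals"
      using c s by (auto intro!: dyadic_intros)
  qed (simp add: two_slope_right[of s m] s c_def algebra_simps)
  have "dyadic_PL_at ?f x" for x
  proof -
    define m where "m = \<lfloor>x\<rfloor>"
    have m: "of_int m \<le> x" "x < of_int m + 1" by (auto simp: m_def)
    consider "x = of_int m" | "of_int m < x" "x < of_int m + s" | "x = of_int m + s"
      | "of_int m + s < x" using m by linarith
    thus ?thesis
    proof cases
      case 1
      thus ?thesis using L[of m] R[of "m - 1"] s unfolding dyadic_PL_at_def
        by (intro exI[of _ "of_int m - 1 + s"] exI[of _ "of_int m + s"]) auto
    next
      case 2
      thus ?thesis using L[of m] unfolding dyadic_PL_at_def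
        by (intro exI[of _ "of_int m"] exI[of _ "of_int m + s"])
          (auto elim: dyadic_affine_subset)
    next
      case 3
      thus ?thesis using L[of m] R[of m] s unfolding dyadic_PL_at_def
        by (intro exI[of _ "of_int m"] exI[of _ "of_int m + 1"]) (auto intro: dyadic_add)
    next
      case 4
      thus ?thesis using R[of m] m unfolding dyadic_PL_at_def
        by (intro exI[of _ "of_int m + s"] exI[of _ "of_int m + 1"])
          (auto elim: dyadic_affine_subset)
    qed
  qed
  thus ?thesis unfolding dyadic_PL_homeos_def
    using two_slope_strict_mono two_slope_surj s by auto
qed

lemma two_slope_0: "0 < s \<Longrightarrow> s < 1 \<Longrightarrow> two_slope i j s 0 = 0"
  using two_slope_left[of s 0 0 i j] by simp

text \<open>The two orders of the slopes $2^a$ and $2^{a+1}$ yield different preimages of $1$, namely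
  $2^{-(a+1)}$ and $2^{-a}$, and hence different roots $p^{-1} t p$ of the unit translation $t$.\<close>

lemma exists_two_stretching_homeos:
  fixes n :: nat
  assumes n: "2 ^ a < n" "n < 2 ^ Suc a"
  shows "\<exists>p. (\<forall>b. p b \<in> dyadic_PL_homeos \<and> p b 0 = 0 \<and> (\<forall>x. p b (x + 1) = p b x + n)) \<and>
    inverse_fun (p True) 1 \<noteq> inverse_fun (p False) (1 :: real)"
proof -
  \<comment> \<open>The length on which the slope is \<open>2 ^ Suc a\<close>: it solves
    \<open>2 ^ Suc a * s + 2 ^ a * (1 - s) = n\<close>.\<close>
  define s where "s = real n / 2 ^ a - 1"
  have n': "2 ^ a + 1 \<le> real n" "real n + 1 \<le> 2 * 2 ^ a"
  proof -
    have "real (2 ^ a + 1) \<le> real n" "real (n + 1) \<le> real (2 * 2 ^ a)"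
      using n unfolding of_nat_le_iff by simp_all
    thus "2 ^ a + 1 \<le> real n" "real n + 1 \<le> 2 * 2 ^ a" by simp_all
  qed
  have s: "0 < s" "s < 1" using n n' by (simp_all add: s_def field_simps)
  have s_dyadic: "s \<in> dyadic_rationals"
  proof -
    have "s = real n * (1 / 2 ^ a) - 1" by (simp add: s_def)
    thus ?thesis by (metis dyadic_of_nat dyadic_1 dyadic_mult dyadic_diff dyadic_inverse_power)
  qed
  define p where "p b = (if b then two_slope (Suc a) a s else two_slope a (Suc a) (1 - s))" for b
  have 1: "p b \<in> dyadic_PL_homeos" for b
    using s s_dyadic by (auto simp: p_def intro!: two_slope_homeo dyadic_diff)
  have 2: "p b 0 = 0" for b using s by (simp add: p_def two_slope_0)
  have 3: "p b (x + 1) = p b x + n" for b x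
    by (simp add: p_def two_slope_add_1) (simp add: s_def field_simps)
  have "p True (1 / 2 ^ Suc a) = 1"
    using s n' two_slope_left[of s 0 "1 / 2 ^ Suc a" "Suc a" a]
    by (simp add: p_def) (simp add: s_def field_simps)
  moreover have "p False (1 / 2 ^ a) = 1"
    using s n' two_slope_left[of "1 - s" 0 "1 / 2 ^ a" a "Suc a"]
    by (simp add: p_def) (simp add: s_def field_simps)
  ultimately have "inverse_fun (p True) 1 = 1 / 2 ^ Suc a" "inverse_fun (p False) 1 = 1 / 2 ^ a"
    using dyadic_PL_homeosD(5)[OF 1] by metis+
  moreover have "(1 :: real) / 2 ^ Suc a < 1 / 2 ^ a" by (simp add: field_simps)
  ultimately have "inverse_fun (p True) 1 \<noteq> inverse_fun (p False) 1" by simp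
  thus ?thesis using 1 2 3 by blast
qed

lemma exists_power_of_two_bounds:
  "\<exists>a. 2 ^ a < 3 * Suc k \<and> 3 * Suc k < 2 ^ Suc a"
proof -
  obtain a where a: "2 ^ a \<le> 3 * Suc k" "3 * Suc k < 2 ^ (a + 1)"
    using ex_power_ivl1[of 2 "3 * Suc k"] by auto
  have "\<not> 3 dvd (2 :: nat) ^ a"
  proof (induction a)
    case (Suc a)
    thus ?case by (simp add: dvd_eq_mod_eq_0) presburger
  qed simp
  hence "2 ^ a \<noteq> 3 * Suc k" by (metis dvd_triv_left)
  thus ?thesis using a by (metis Suc_eq_plus1 le_neq_implies_less)
qed


section \<open>Copies of the rationals from towers of stretching maps\<close>

text \<open>A sequence of maps that each stretch the unit translation by an integer factor. The
  divisibility assumption ensures that every rational number becomes an integer when it is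
  multiplied by the product of sufficiently many of these factors.\<close>

locale stretching_tower =
  fixes p :: "nat \<Rightarrow> real \<Rightarrow> real" and n :: "nat \<Rightarrow> nat"
  assumes p_homeo: "p k \<in> dyadic_PL_homeos"
    and p_0: "p k 0 = 0"
    and p_add_1: "p k (x + 1) = p k x + n k"
    and n_pos: "n k > 0"
    and Suc_dvd_n: "Suc k dvd n k"
begin

text \<open>The composition of the first $k$ maps.\<close>

primrec tower :: "nat \<Rightarrow> real \<Rightarrow> real" where
  "tower 0 = id"
| "tower (Suc k) = p k \<circ> tower k"

text \<open>The factor by which the composition of the first $k$ maps stretches the unit translation.\<close>

definition stretch :: "nat \<Rightarrow> nat" where "stretch k = (\<Prod>i<k. n i)"

text \<open>The translation by \<open>r * stretch k\<close>, conjugated by the composition of the first $k$ maps.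
  It commutes with the unit translation, and does not change with increasing $k$ once
  \<open>r * stretch k\<close> is an integer.\<close>

definition pull :: "nat \<Rightarrow> real \<Rightarrow> real \<Rightarrow> real" where
  "pull k r x = inverse_fun (tower k) (tower k x + r * stretch k)"

text \<open>Some $k$ for which \<open>of_rat q * stretch k\<close> is an integer; the choice does not matter, by
  \<open>rat_shift_eq_pull\<close> below.\<close>

definition level :: "rat \<Rightarrow> nat" where
  "level q = (SOME k. of_rat q * stretch k \<in> \<int>)"

text \<open>The action of the rational number $q$ on the line; the number $1$ acts as the unit
  translation.\<close>

definition rat_shift :: "rat \<Rightarrow> real \<Rightarrow> real" where
  "rat_shift q = pull (level q) (of_rat q)"

lemma stretch_pos: "stretch k > 0"
  by (simp add: stretch_def n_pos prod_pos)

lemma stretch_Suc: "stretch (Suc k) = stretch k * n k"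
  by (simp add: stretch_def)

lemma tower_homeo: "tower k \<in> dyadic_PL_homeos"
  using dyadic_translation_homeo[of 0]
  by (induction k) (auto simp: id_def intro: dyadic_PL_homeos_comp p_homeo)

lemma tower_0 [simp]: "tower k 0 = 0"
  by (induction k) (simp_all add: p_0)

lemma p_add_int: "p k (x + of_int m) = p k x + of_int m * n k"
proof (induction m rule: int_induct[where k = 0])
  case (step1 i)
  thus ?case using p_add_1[of k "x + of_int i"] by (simp add: algebra_simps)
next
  case (step2 i)
  thus ?case using p_add_1[of k "x + of_int i - 1"] by (simp add: algebra_simps)
qed simp

lemma tower_add_1: "tower k (x + 1) = tower k x + stretch k"
proof (induction k)
  case (Suc k)
  thus ?case using p_add_int[of k "tower k x" "int (stretch k)"] by (simp add: stretch_Suc)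
qed (simp add: stretch_def)

lemma tower_inverse [simp]:
  "inverse_fun (tower k) (tower k x) = x" "tower k (inverse_fun (tower k) x) = x"
  using dyadic_PL_homeosD[OF tower_homeo[of k]] by auto

lemma tower_eq_iff [simp]: "tower k x = tower k y \<longleftrightarrow> x = y"
  by (metis tower_inverse(1))

lemma tower_pull [simp]: "tower k (pull k r x) = tower k x + r * stretch k"
  by (simp add: pull_def)

lemma pull_Suc:
  fixes r :: real
  assumes "r * stretch k \<in> \<int>"
  shows "pull (Suc k) r = pull k r"
proof
  fix x
  obtain m where "r * stretch k = of_int m" using assms by (auto elim: Ints_cases)
  hence "tower (Suc k) (pull k r x) = tower (Suc k) x + r * stretch (Suc k)"
    using p_add_int[of k "tower k x" m] by (simp add: stretch_Suc flip: mult.assoc)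
  also have "\<dots> = tower (Suc k) (pull (Suc k) r x)" by (simp only: tower_pull)
  finally show "pull (Suc k) r x = pull k r x" by (simp only: tower_eq_iff)
qed

lemma integral_mono:
  fixes r :: real
  assumes "r * stretch k \<in> \<int>" "k \<le> j"
  shows "r * stretch j \<in> \<int>"
  using assms(2)
proof (induction j rule: dec_induct)
  case (step j)
  have "r * stretch (Suc j) = r * stretch j * of_nat (n j)" by (simp add: stretch_Suc)
  thus ?case using step by (metis Ints_mult Ints_of_nat)
qed (rule assms)

lemma pull_eq:
  fixes r :: real
  assumes "r * stretch k \<in> \<int>" "k \<le> j"
  shows "pull j r = pull k r"
  using assms(2)
proof (induction j rule: dec_induct)
  case (step j)
  thus ?case using pull_Suc[of r j] integral_mono[OF assms(1)] by simp
qed simp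

lemma level_integral: "of_rat q * stretch (level q) \<in> \<int>"
proof -
  obtain a b where ab: "quotient_of q = (a, b)" by (cases "quotient_of q")
  hence b: "b > 0" and q: "q = of_int a / of_int b"
    using quotient_of_denom_pos quotient_of_div by auto
  define k where "k = nat b - 1"
  have "nat b dvd stretch (Suc k)"
    using Suc_dvd_n[of k] b unfolding stretch_Suc by (intro dvd_mult) (simp add: k_def)
  then obtain c where "stretch (Suc k) = nat b * c" by (auto elim: dvdE)
  hence "real (stretch (Suc k)) = of_int b * of_nat c" using b by simp
  hence "of_rat q * real (stretch (Suc k)) = of_int (a * int c)"
    using b by (simp add: q of_rat_divide)
  hence "\<exists>k. of_rat q * real (stretch k) \<in> \<int>" by (metis Ints_of_int)
  thus ?thesis unfolding level_def by (rule someI_ex)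
qed

lemma rat_shift_eq_pull:
  assumes "of_rat q * stretch k \<in> \<int>"
  shows "rat_shift q = pull k (of_rat q)"
  using pull_eq[OF assms, of "max k (level q)"] pull_eq[OF level_integral, of q "max k (level q)"]
  by (simp add: rat_shift_def)

lemma rat_shift_add: "rat_shift (q + r) = rat_shift q \<circ> rat_shift r"
proof -
  define k where "k = max (level q) (level r)"
  have 1: "of_rat q * real (stretch k) \<in> \<int>" "of_rat r * real (stretch k) \<in> \<int>"
    by (rule integral_mono[OF level_integral], simp add: k_def)+
  hence 2: "of_rat (q + r) * real (stretch k) \<in> \<int>" by (simp add: of_rat_add distrib_right)
  have "tower k (pull k (of_rat (q + r)) x) = tower k (pull k (of_rat q) (pull k (of_rat r) x))" for x
    by (simp add: of_rat_add distrib_right)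
  hence "pull k (of_rat (q + r)) x = pull k (of_rat q) (pull k (of_rat r) x)" for x
    by (simp only: tower_eq_iff)
  thus ?thesis using rat_shift_eq_pull[OF 1(1)] rat_shift_eq_pull[OF 1(2)] rat_shift_eq_pull[OF 2]
    by (simp add: fun_eq_iff)
qed

lemma rat_shift_of_int: "rat_shift (of_int m) = (\<lambda>x. x + of_int m)"
proof -
  have "rat_shift (of_int m) = pull 0 (of_int m)" using rat_shift_eq_pull[of "of_int m" 0] by simp
  also have "\<dots> = (\<lambda>x. x + of_int m)"
    using tower_pull[of 0 "of_int m"] by (simp add: fun_eq_iff stretch_def)
  finally show ?thesis .
qed

lemma rat_shift_0: "rat_shift 0 = id"
  using rat_shift_of_int[of 0] by (simp add: id_def)

lemma inj_rat_shift: "inj rat_shift"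
proof (rule injI)
  fix q r assume "rat_shift q = rat_shift r"
  define k where "k = max (level q) (level r)"
  have "of_rat q * real (stretch k) \<in> \<int>" "of_rat r * real (stretch k) \<in> \<int>"
    by (rule integral_mono[OF level_integral], simp add: k_def)+
  hence "pull k (of_rat q) 0 = pull k (of_rat r) 0"
    using \<open>rat_shift q = rat_shift r\<close> rat_shift_eq_pull by metis
  hence "tower k (pull k (of_rat q) 0) = tower k (pull k (of_rat r) 0)" by simp
  thus "q = r" using stretch_pos[of k] by simp
qed

lemma rat_shift_Tbar: "rat_shift q \<in> Tbar_set"
proof (rule dyadic_PL_homeos_imp_Tbar)
  define k where "k = level q"
  obtain m where m: "of_rat q * stretch k = of_int m"
    using level_integral[of q] by (auto simp: k_def elim: Ints_cases)
  have "rat_shift q = inverse_fun (tower k) \<circ> ((\<lambda>x. x + of_int m) \<circ> tower k)"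
    by (simp add: rat_shift_def pull_def fun_eq_iff m flip: k_def)
  thus "rat_shift q \<in> dyadic_PL_homeos"
    using tower_homeo[of k] by (auto intro!: dyadic_PL_homeos_comp dyadic_PL_homeos_inverse
      dyadic_translation_homeo)
  have "rat_shift q \<circ> rat_shift (of_int 1) = rat_shift (of_int 1) \<circ> rat_shift q"
    by (metis add.commute rat_shift_add)
  thus "rat_shift q (x + 1) = rat_shift q x + 1" for x
    unfolding rat_shift_of_int by (simp add: fun_eq_iff)
qed

lemma rat_shift_funpow: "rat_shift q ^^ m = rat_shift (of_nat m * q)"
  by (induction m) (simp_all add: rat_shift_0 rat_shift_add distrib_right)

lemma subgroup_rat_shifts: "subgroup (range rat_shift) Tbar"
proof (rule subgroup.intro)
  show "range rat_shift \<subseteq> carrier Tbar" using rat_shift_Tbar by (auto simp: Tbar_def)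
  show "\<one>\<^bsub>Tbar\<^esub> \<in> range rat_shift" using rat_shift_0 by (auto simp: Tbar_def image_iff) metis
next
  fix f g assume "f \<in> range rat_shift" "g \<in> range rat_shift"
  thus "f \<otimes>\<^bsub>Tbar\<^esub> g \<in> range rat_shift" by (auto simp: Tbar_def simp flip: rat_shift_add)
next
  fix f assume "f \<in> range rat_shift"
  then obtain q where q: "f = rat_shift q" by auto
  have inv: "rat_shift q \<circ> rat_shift (- q) = id" "rat_shift (- q) \<circ> rat_shift q = id"
    by (simp_all add: rat_shift_0 flip: rat_shift_add)
  have "inv\<^bsub>Tbar\<^esub> f = rat_shift (- q)"
    unfolding m_inv_def
  proof (rule the_equality)
    show "rat_shift (- q) \<in> carrier Tbar \<and> f \<otimes>\<^bsub>Tbar\<^esub> rat_shift (- q) = \<one>\<^bsub>Tbar\<^esub> \<and>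
        rat_shift (- q) \<otimes>\<^bsub>Tbar\<^esub> f = \<one>\<^bsub>Tbar\<^esub>"
      using inv rat_shift_Tbar by (simp add: q Tbar_def)
  next
    fix g assume "g \<in> carrier Tbar \<and> f \<otimes>\<^bsub>Tbar\<^esub> g = \<one>\<^bsub>Tbar\<^esub> \<and> g \<otimes>\<^bsub>Tbar\<^esub> f = \<one>\<^bsub>Tbar\<^esub>"
    hence "rat_shift q \<circ> g = id" by (simp add: q Tbar_def)
    thus "g = rat_shift (- q)" using inv(2) by (metis comp_assoc comp_id id_comp)
  qed
  thus "inv\<^bsub>Tbar\<^esub> f \<in> range rat_shift" by simp
qed

lemma rat_shifts_iso: "Tbar\<lparr>carrier := range rat_shift\<rparr> \<cong> rational_group"
proof (rule is_isoI)
  have "inverse_fun rat_shift (rat_shift q \<circ> rat_shift r) = q + r" for q r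
    by (simp add: inj_rat_shift flip: rat_shift_add)
  thus "inverse_fun rat_shift \<in> iso (Tbar\<lparr>carrier := range rat_shift\<rparr>) rational_group"
    using inj_rat_shift
    by (auto simp: iso_def hom_def Tbar_def rational_group_def inj_imp_bij_betw_inv)
qed

end

text \<open>The image of $0$ under the action of \<open>1 / stretch k\<close> is the preimage of $1$ under the tower.
  The group determines it, because the action of \<open>1 / stretch k\<close> is the only element of the group
  whose power with exponent \<open>stretch k\<close> is the unit translation.\<close>

lemma stretching_tower_shift_unit:
  assumes "stretching_tower p n" "stretching_tower p' n"
    and eq: "range (stretching_tower.rat_shift p n) = range (stretching_tower.rat_shift p' n)"
  shows "inverse_fun (stretching_tower.tower p k) 1 = inverse_fun (stretching_tower.tower p' k) 1"
proof -
  interpret A: stretching_tower p n by fact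
  interpret B: stretching_tower p' n by fact
  define N where "N = A.stretch k"
  have N: "N > 0" "B.stretch k = N" 
    using A.stretch_pos by (auto simp: N_def A.stretch_def B.stretch_def)
  define q :: rat where "q = 1 / of_nat N"
  have q: "of_nat N * q = of_int 1" "of_rat q * real N = of_int 1"
    using N by (auto simp: q_def of_rat_divide)
  obtain r where r: "B.rat_shift q = A.rat_shift r" using eq by blast
  have "A.rat_shift (of_nat N * r) = B.rat_shift (of_nat N * q)"
    by (simp only: r flip: A.rat_shift_funpow B.rat_shift_funpow)
  also have "\<dots> = A.rat_shift (of_int 1)"
    unfolding q by (simp only: A.rat_shift_of_int B.rat_shift_of_int)
  finally have "of_nat N * r = of_nat N * q"
    using A.inj_rat_shift q by (simp add: inj_eq)
  hence "r = q" using N by simp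
  hence "A.rat_shift q 0 = B.rat_shift q 0" using r by simp
  moreover have "A.rat_shift q = A.pull k (of_rat q)" "B.rat_shift q = B.pull k (of_rat q)"
    using A.rat_shift_eq_pull[of q k] B.rat_shift_eq_pull[of q k]
    unfolding N(2) N_def[symmetric] q(2) by simp_all
  ultimately have "A.pull k (of_rat q) 0 = B.pull k (of_rat q) 0" by simp
  thus ?thesis unfolding A.pull_def B.pull_def N(2) N_def[symmetric] q(2) by simp
qed


section \<open>The center consists of integer translations\<close>

text \<open>The map with slopes $2$ and $4$ on the two halves of the unit
  interval increases by more than $1$ over an interval of length $1/2$ that starts at a noninteger.\<close>

lemma integer_if_two_slope_half_shift:
  assumes "two_slope 1 2 (1 / 2) (c + 1 / 2) = two_slope 1 2 (1 / 2) c + 1"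
  shows "c \<in> \<int>"
proof -
  define m where "m = \<lfloor>c\<rfloor>"
  have m: "of_int m \<le> c" "c < of_int m + 1" by (auto simp: m_def)
  have "c = of_int m"
  proof (cases "c \<le> of_int m + 1 / 2")
    case True
    thus ?thesis
      using assms m two_slope_left[of "1 / 2" m c 1 2] two_slope_right[of "1 / 2" m "c + 1 / 2" 1 2]
      by simp
  next
    case False
    thus ?thesis using assms m two_slope_right[of "1 / 2" m c 1 2]
        two_slope_left[of "1 / 2" "m + 1" "c + 1 / 2" 1 2]
      by (simp add: algebra_simps)
  qed
  thus ?thesis by simp
qed

lemma center_Tbar_integer_translation:
  assumes z: "z \<in> group_center Tbar"
  shows "\<exists>m :: int. z = (\<lambda>x. x + of_int m)"
proof -
  define c where "c = z 0"
  have z_Tbar: "z \<in> Tbar_set" using z by (simp add: group_center_def Tbar_def)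
  have comm: "z (g x) = g (z x)" if "g \<in> Tbar_set" for g x
    using z that by (auto simp: group_center_def Tbar_def fun_eq_iff)
  have "z d = d + c" if "d \<in> dyadic_rationals" for d
    using comm[of "\<lambda>x. x + d" 0] dyadic_PL_homeos_imp_Tbar[OF dyadic_translation_homeo[OF that]]
    by (simp add: c_def)
  hence "z x = x + c" for x
    using continuous_constant_on_closure[of dyadic_rationals "\<lambda>x. z x - x" c x]
      Tbar_set_continuous[OF z_Tbar]
    by (simp add: dyadic_rationals_dense continuous_on_diff)
  note z_eq = this
  \<comment> \<open>It remains to see that \<open>c\<close> is an integer. The element \<open>g\<close> below maps \<open>x\<close> to \<open>x + 1 / 2\<close> exactly
    when \<open>x\<close> is an integer; as \<open>g\<close> commutes with \<open>z\<close>, it does so at \<open>c\<close>, as it does at \<open>0\<close>.\<close>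
  define p where "p = two_slope 1 2 (1 / 2)"
  have p: "p \<in> dyadic_PL_homeos"
    unfolding p_def using dyadic_inverse_power[of 1] by (intro two_slope_homeo) simp_all
  note pD = dyadic_PL_homeosD[OF p]
  have p_add_1: "p (x + 1) = p x + 3" for x by (simp add: p_def two_slope_add_1)
  define g where "g = inverse_fun p \<circ> ((\<lambda>x. x + 1) \<circ> p)"
  have "g \<in> Tbar_set"
  proof (rule dyadic_PL_homeos_imp_Tbar)
    show "g \<in> dyadic_PL_homeos" unfolding g_def
      by (intro dyadic_PL_homeos_comp dyadic_PL_homeos_inverse p dyadic_translation_homeo) simp
    show "g (x + 1) = g x + 1" for x
    proof -
      have "p (g (x + 1)) = p (g x + 1)" by (simp add: g_def pD(6) p_add_1)
      thus ?thesis using pD(3) by (simp add: inj_eq)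
    qed
  qed
  have "p 0 = 0" "p (1 / 2) = 1"
    using two_slope_left[of "1 / 2" 0 0 1 2] two_slope_left[of "1 / 2" 0 "1 / 2" 1 2]
    by (simp_all add: p_def)
  hence "g 0 = 1 / 2" using pD(5)[of "1 / 2"] by (simp add: g_def)
  hence "g c = c + 1 / 2" using comm[OF \<open>g \<in> Tbar_set\<close>, of 0] by (simp add: z_eq)
  hence "p (c + 1 / 2) = p c + 1" using pD(6)[of "p c + 1"] by (simp add: g_def)
  hence "c \<in> \<int>" unfolding p_def by (rule integer_if_two_slope_half_shift)
  then obtain m where "c = of_int m" by (auto elim: Ints_cases)
  thus ?thesis using z_eq by (intro exI[of _ m]) (simp add: fun_eq_iff)
qed

lemma (in stretching_tower) center_subset_rat_shifts: "group_center Tbar \<subseteq> range rat_shift"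
proof
  fix z assume "z \<in> group_center Tbar"
  then obtain m :: int where "z = rat_shift (of_int m)"
    using center_Tbar_integer_translation rat_shift_of_int by metis
  thus "z \<in> range rat_shift" by simp
qed

section \<open>Counting the subgroups\<close>

lemma eq_if_same_rational_cut:
  fixes a b :: real
  assumes "\<And>s :: rat. of_rat s < a \<longleftrightarrow> of_rat s < b"
  shows "a = b"
  using assms of_rat_dense by (metis linorder_neqE order_less_asym)

text \<open>A subgroup isomorphic to $\mathbb{Q}$ is the image of a family of continuous functions indexed
  by the rationals. Each of these functions is determined by the lower cuts of its values at
  rational points, so the whole family is encoded by a set of triples of rationals.\<close>

lemma rational_subgroups_lepoll:
  "{H. subgroup H Tbar \<and> Tbar\<lparr>carrier := H\<rparr> \<cong> rational_group \<and> group_center Tbar \<subseteq> H}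
     \<lesssim> (UNIV :: nat set set)" (is "?X \<lesssim> _")
proof -
  have "\<exists>\<phi> :: rat \<Rightarrow> real \<Rightarrow> real. range \<phi> = H" if H: "H \<in> ?X" for H
  proof -
    obtain \<psi> where "bij_betw \<psi> H (UNIV :: rat set)"
      using H by (auto simp: is_iso_def iso_def rational_group_def)
    hence "bij_betw (inv_into H \<psi>) UNIV H" by (rule bij_betw_inv_into)
    thus ?thesis unfolding bij_betw_def by blast
  qed
  note ex = this
  define \<phi> :: "(real \<Rightarrow> real) set \<Rightarrow> rat \<Rightarrow> real \<Rightarrow> real"
    where "\<phi> H = (SOME \<phi>. range \<phi> = H)" for H
  have \<phi>: "range (\<phi> H) = H" if "H \<in> ?X" for H
    unfolding \<phi>_def by (rule someI_ex[OF ex[OF that]])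
  define cuts where "cuts H = {(q, r, s :: rat). of_rat s < \<phi> H q (of_rat r)}" for H
  have "inj_on (\<lambda>H. to_nat ` cuts H) ?X"
  proof (rule inj_onI)
    fix H K assume H: "H \<in> ?X" and K: "K \<in> ?X" and "to_nat ` cuts H = to_nat ` cuts K"
    hence "cuts H = cuts K" by (simp add: inj_image_eq_iff)
    hence cuts: "of_rat s < \<phi> H q (of_rat r) \<longleftrightarrow> of_rat s < \<phi> K q (of_rat r)" for q r s
      unfolding cuts_def by blast
    have at_rat: "\<phi> H q (of_rat r) = \<phi> K q (of_rat r)" for q r
      using cuts by (intro eq_if_same_rational_cut) blast
    have "continuous_on UNIV f" if "f \<in> L" "L \<in> ?X" for f L
      using that Tbar_set_continuous by (auto simp: Tbar_def dest!: subgroup.subset)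
    hence cont: "continuous_on UNIV (\<phi> H q)" "continuous_on UNIV (\<phi> K q)" for q
      using H K \<phi> by blast+
    have "\<phi> H q x = \<phi> K q x" for q x
    proof -
      have "\<phi> H q x - \<phi> K q x = 0"
      proof (rule continuous_constant_on_closure[of \<rat> "\<lambda>x. \<phi> H q x - \<phi> K q x" 0 x])
        show "continuous_on (closure \<rat>) (\<lambda>x. \<phi> H q x - \<phi> K q x)"
          unfolding Rats_closure_real using cont by (intro continuous_on_diff)
        show "\<phi> H q x - \<phi> K q x = 0" if "x \<in> \<rat>" for x
          using that at_rat by (cases rule: Rats_cases) simp
      qed (simp add: Rats_closure_real)
      thus ?thesis by simp
    qed
    hence "\<phi> H = \<phi> K" by (intro ext)
    thus "H = K" using \<phi>[OF H] \<phi>[OF K] by metis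
  qed
  thus ?thesis unfolding lepoll_def by blast
qed

lemma tower_cong:
  assumes "stretching_tower p n" "stretching_tower p' n" "\<And>i. i < k \<Longrightarrow> p i = p' i"
  shows "stretching_tower.tower p k = stretching_tower.tower p' k"
proof -
  interpret A: stretching_tower p n by fact
  interpret B: stretching_tower p' n by fact
  show ?thesis using assms(3) by (induction k) simp_all
qed

text \<open>A set \<open>A\<close> of natural numbers is encoded by the group of the tower whose $k$-th map is the
  first or the second of the two maps with factor $3(k+1)$, according to membership of $k$ in \<open>A\<close>.
  The factor $3$ keeps this number from being a power of two.\<close>

lemma lepoll_rational_subgroups:
  "(UNIV :: nat set set) \<lesssim>
     {H. subgroup H Tbar \<and> Tbar\<lparr>carrier := H\<rparr> \<cong> rational_group \<and> group_center Tbar \<subseteq> H}"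
proof -
  define n :: "nat \<Rightarrow> nat" where "n k = 3 * Suc k" for k
  have "\<exists>p. (\<forall>b. p b \<in> dyadic_PL_homeos \<and> p b 0 = 0 \<and> (\<forall>x. p b (x + 1) = p b x + n k)) \<and>
    inverse_fun (p True) 1 \<noteq> inverse_fun (p False) (1 :: real)" for k
    using exists_power_of_two_bounds[of k] exists_two_stretching_homeos unfolding n_def by blast
  then obtain P where P: "\<And>k b. P k b \<in> dyadic_PL_homeos" "\<And>k b. P k b 0 = 0"
    "\<And>k b x. P k b (x + 1) = P k b x + n k"
    and P_neq: "\<And>k. inverse_fun (P k True) 1 \<noteq> inverse_fun (P k False) (1 :: real)"
    by metis
  define choice where "choice A k = P k (k \<in> A)" for A k
  have tower: "stretching_tower (choice A) n" for A
  proof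
    show "Suc k dvd n k" for k unfolding n_def by (rule dvd_triv_right)
  qed (simp_all add: choice_def P n_def)
  define S where "S A = range (stretching_tower.rat_shift (choice A) n)" for A
  have "inj S"
  proof (rule injI)
    fix A B assume "S A = S B"
    have "k \<in> A \<longleftrightarrow> k \<in> B" for k
    proof (induction k rule: less_induct)
      case (less k)
      interpret A: stretching_tower "choice A" n by (rule tower)
      interpret B: stretching_tower "choice B" n by (rule tower)
      have same: "A.tower k = B.tower k"
        using less by (intro tower_cong[OF tower tower]) (simp add: choice_def)
      define y where "y = inverse_fun (A.tower (Suc k)) 1"
      have "y = inverse_fun (B.tower (Suc k)) 1"
        unfolding y_def using \<open>S A = S B\<close> unfolding S_def
        by (rule stretching_tower_shift_unit[OF tower tower])
      hence "B.tower (Suc k) y = 1" by (simp only: B.tower_inverse)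
      moreover have "A.tower (Suc k) y = 1" unfolding y_def by (rule A.tower_inverse)
      ultimately have "P k (k \<in> A) (A.tower k y) = 1" "P k (k \<in> B) (A.tower k y) = 1"
        using same by (simp_all add: choice_def)
      hence "inverse_fun (P k (k \<in> A)) 1 = inverse_fun (P k (k \<in> B)) 1"
        using dyadic_PL_homeosD(5)[OF P(1)] by metis
      thus ?case using P_neq[of k] by (cases "k \<in> A"; cases "k \<in> B") auto
    qed
    thus "A = B" by blast
  qed
  moreover have "S A \<in> {H. subgroup H Tbar \<and> Tbar\<lparr>carrier := H\<rparr> \<cong> rational_group \<and>
      group_center Tbar \<subseteq> H}" for A
  proof -
    interpret stretching_tower "choice A" n by (rule tower)
    show ?thesis
      using subgroup_rat_shifts rat_shifts_iso center_subset_rat_shifts by (simp add: S_def)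
  qed
  ultimately show ?thesis unfolding lepoll_def by blast
qed

theorem theorem1:
  shows "{H. subgroup H Tbar \<and> Tbar\<lparr>carrier := H\<rparr> \<cong> rational_group \<and> group_center Tbar \<subseteq> H}
           \<approx> (UNIV :: nat set set)"
  using rational_subgroups_lepoll lepoll_rational_subgroups by (rule lepoll_antisym)

end
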